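(* Let $\mathbb{F}\in\{\mathbb{R},\mathbb{C},\mathbb{H}\}$ and let $A=\operatorname{DPR1}(\Delta,x,y,\rho)\in\mathbb{F}^{n\times n}$ be a non-singular diagonal-plus-rank-one matrix. (1) If all $\delta_j\neq0$, $j=1,\dots,n$, then the inverse of $A$ is the diagonal-plus-rank-one matrix $$ A^{-1}=\operatorname{DPR1}(\hat\Delta,\hat x,\hat y,\hat\rho)=\hat\Delta+\hat x\hat\rho\hat y^\star, $$ where $$ \hat\Delta=\Delta^{-1},\quad \hat x=\Delta^{-1}x,\quad \hat y=\Delta^{-\star}y,\quad \hat\rho=-\rho\,(1+y^\star\Delta^{-1}x\rho)^{-1}. $$ (2) If $\delta_j=0$ for some $j\in\{1,\dots,n\}$, then the inverse of $A$ is an arrowhead matrix with the tip of the arrow at position $(j,j)$. In particular, let $P$ be the permutation matrix of the permutation $p=(1,2,\dots,j-1,n,j,j+1,\dots,n-1)$, and partition $$ \Delta=\begin{bmatrix} \Delta_1 & 0 & 0 \\ 0 & 0 & 0 \\ 0 & 0 & \Delta_2 \end{bmatrix},\quad x=\begin{bmatrix} x_1 \\ x_j \\ x_2 \end{bmatrix},\quad y=\begin{bmatrix} y_1 \\ y_j \\ y_2 \end{bmatrix}, $$ where the middle row and column correspond to index $j$ (so $x_j,y_j\in\mathbb{F}$, while $x_1,x_2,y_1,y_2$ are subvectors). Then $$ A^{-1}=P\begin{bmatrix} D & u \\ v^\star & \alpha \end{bmatrix}P^T, $$ where $$ D=\begin{bmatrix} \Delta_1^{-1} & 0 \\ 0 &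 \Delta_2^{-1} \end{bmatrix},\quad u=\begin{bmatrix} -\Delta_1^{-1}x_1 \\ -\Delta_2^{-1}x_2 \end{bmatrix}x_j^{-1},\quad v=\begin{bmatrix} -\Delta_1^{-\star}y_1 \\ -\Delta_2^{-\star}y_2 \end{bmatrix}y_j^{-1}, $$ $$ \alpha=y_j^{-\star}\left(\rho^{-1}+y_1^\star\Delta_1^{-1}x_1+y_2^\star\Delta_2^{-1}x_2\right)x_j^{-1}. $$
   Context: $\mathbb{H}$ is the (non-commutative) skew field of real quaternions; products are taken in the order written. $\star$ denotes the transpose of a real matrix, the conjugate transpose of a complex or quaternionic matrix or vector, and the conjugate of a scalar; $X^{-\star}=(X^{-1})^\star$. Diagonal-plus-rank-one matrix: $\operatorname{DPR1}(\Delta,x,y,\rho)=\Delta+x\rho y^\star$, where $\Delta\in\mathbb{F}^{n\times n}$ is diagonal with diagonal elements $\delta_1,\dots,\delta_n$, $x,y\in\mathbb{F}^n$ and $\rho\in\mathbb{F}$. Permutation matrices: the permutation matrix $P$ of $p=(p_1,\dots,p_n)$ is the one with $(Pa)_k=a_{p_k}$ for every vector $a$, i.e. $P_{k,p_k}=1$ and all other entries $0$. Thus $P$ above moves the last entry of a vector to position $j$ and keeps the order of the others. Arrowhead matrix: a matrix $\begin{bmatrix} D & u \\ v^\star & \alpha \end{bmatrix}\in\mathbb{F}^{n\times n}$ with $D$ diagonal of order $n-1$, $u,v\in\mathbb{F}^{n-1}$, $\alpha\in\mathbb{F}$, or any symmetric permutation of such a matrix; its tip is the diagonal position of $\alpha$.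 In the partition above, the blocks with subscript $1$ or $2$ may be empty. *)

theory Defs
  imports
    "Jordan_Normal_Form.Matrix"
    "HOL-Combinatorics.Permutations"
begin

section \<open>Quaternions\<close>

datatype quat = Quat (qRe: real) (qI: real) (qJ: real) (qK: real)

lemma quat_eq_iff:
  "p = q \<longleftrightarrow> qRe p = qRe q \<and> qI p = qI q \<and> qJ p = qJ q \<and> qK p = qK q"
  by (cases p; cases q) auto

instantiation quat :: ring_1
begin

definition "0 = Quat 0 0 0 0"
definition "1 = Quat 1 0 0 0"
definition "p + q = Quat (qRe p + qRe q) (qI p + qI q) (qJ p + qJ q) (qK p + qK q)"
definition "p - q = Quat (qRe p - qRe q) (qI p - qI q) (qJ p - qJ q) (qK p - qK q)"
definition "- p = Quat (- qRe p) (- qI p) (- qJ p) (- qK p)"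

text \<open>The Hamilton product, determined by \<open>i\<^sup>2 = j\<^sup>2 = k\<^sup>2 = i j k = -1\<close>.\<close>

definition "p * q = Quat
  (qRe p * qRe q - qI p * qI q - qJ p * qJ q - qK p * qK q)
  (qRe p * qI q + qI p * qRe q + qJ p * qK q - qK p * qJ q)
  (qRe p * qJ q - qI p * qK q + qJ p * qRe q + qK p * qI q)
  (qRe p * qK q + qI p * qJ q - qJ p * qI q + qK p * qRe q)"

instance
  by standard
    (simp_all add: quat_eq_iff zero_quat_def one_quat_def plus_quat_def minus_quat_def
      uminus_quat_def times_quat_def algebra_simps)

end

instantiation quat :: conjugate
begin

definition "conjugate q = Quat (qRe q) (- qI q) (- qJ q) (- qK q)"

instance
  by standard (auto simp: conjugate_quat_def quat_eq_iff)

end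

definition quat_norm2 :: "quat \<Rightarrow> real" where
  "quat_norm2 q = (qRe q)\<^sup>2 + (qI q)\<^sup>2 + (qJ q)\<^sup>2 + (qK q)\<^sup>2"

lemma quat_norm2_eq_0_iff: "quat_norm2 q = 0 \<longleftrightarrow> q = 0"
  by (auto simp: quat_norm2_def quat_eq_iff zero_quat_def add_nonneg_eq_0_iff)

instantiation quat :: inverse
begin

text \<open>\<open>q\<^sup>-\<^sup>1\<close> is the conjugate of \<open>q\<close> divided by \<open>|q|\<^sup>2\<close>.\<close>

definition "inverse q = Quat (qRe q / quat_norm2 q) (- qI q / quat_norm2 q)
  (- qJ q / quat_norm2 q) (- qK q / quat_norm2 q)"
definition "p div q = p * inverse q" for p q :: quat

instance ..

end

instance quat :: division_ring
proof
  fix a b :: quat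
  show "a / b = a * inverse b" by (rule divide_quat_def)
  show "inverse (0 :: quat) = 0"
    by (simp add: inverse_quat_def zero_quat_def)
  assume "a \<noteq> 0"
  then have n: "quat_norm2 a \<noteq> 0" by (simp add: quat_norm2_eq_0_iff)
  have "(qRe a * qRe a + qI a * qI a + qJ a * qJ a + qK a * qK a) / quat_norm2 a = 1"
    using n by (simp add: quat_norm2_def power2_eq_square)
  then show "inverse a * a = 1" "a * inverse a = 1"
    by (simp_all add: quat_eq_iff inverse_quat_def times_quat_def one_quat_def
        add_divide_distrib mult.commute)
qed


section \<open>The scalar domains: reals, complex numbers, quaternions\<close>

class star_division_ring = division_ring + conjugate

definition (in star_division_ring) star_iso :: "('a \<Rightarrow> 'b::star_division_ring) \<Rightarrow> bool" where
  "star_iso f \<longleftrightarrow> bij f \<and> f 1 = 1 \<and>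
     (\<forall>a b. f (a + b) = f a + f b) \<and>
     (\<forall>a b. f (a * b) = f a * f b) \<and>
     (\<forall>a. f (conjugate a) = conjugate (f a))"

instance real :: star_division_ring ..
instance complex :: star_division_ring ..
instance quat :: star_division_ring ..

text \<open>A type belongs to the class iff it is, up to renaming of its elements, one of the types
  \<^typ>\<open>real\<close> (with trivial conjugation), \<^typ>\<open>complex\<close> and \<^typ>\<open>quat\<close>. Hence a type variable of
  this class stands for a scalar domain that is one of the three.\<close>

class real_complex_quat = star_division_ring +
  assumes real_complex_or_quat:
    "(\<exists>f :: 'a \<Rightarrow> real. star_iso f) \<or> (\<exists>f :: 'a \<Rightarrow> complex. star_iso f) \<or>
     (\<exists>f :: 'a \<Rightarrow> quat. star_iso f)"

instance real :: real_complex_quat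
  by standard (rule disjI1, rule exI[of _ id], simp add: star_iso_def)

instance complex :: real_complex_quat
  by standard (rule disjI2, rule disjI1, rule exI[of _ id], simp add: star_iso_def)

instance quat :: real_complex_quat
  by standard (rule disjI2, rule disjI2, rule exI[of _ id], simp add: star_iso_def)


section \<open>Matrices and vectors over a skew field\<close>

text \<open>The two-sided inverse is unique when it exists; for a matrix without one the value is
  arbitrary.\<close>

definition mat_inv :: "'a::semiring_1 mat \<Rightarrow> 'a mat" where
  "mat_inv A = (SOME B. inverts_mat A B \<and> inverts_mat B A)"

text \<open>The library's adjoint is restricted to commutative fields.\<close>

definition mat_star :: "'a::conjugate mat \<Rightarrow> 'a mat" where
  "mat_star A = transpose_mat (map_mat conjugate A)"

text \<open>Scalars act on column vectors from the right (the library's scalar multiplication acts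
  from the left).\<close>

definition smult_vec_right :: "'a::times vec \<Rightarrow> 'a \<Rightarrow> 'a vec" (infixl "\<cdot>\<^sub>r" 70) where
  "v \<cdot>\<^sub>r a = vec (dim_vec v) (\<lambda>i. v $ i * a)"

text \<open>The product \<open>y\<^sup>\<star> x\<close>, with the conjugated factors on the left.\<close>

definition star_prod :: "'a::{semiring_0,conjugate} vec \<Rightarrow> 'a vec \<Rightarrow> 'a" (infix "\<star>\<bullet>" 70) where
  "y \<star>\<bullet> x = conjugate y \<bullet> x"

text \<open>\<open>DPR1(\<Delta>, x, y, \<rho>) = \<Delta> + x \<rho> y\<^sup>\<star>\<close>; that \<open>\<Delta>\<close> is diagonal is stated where it is used.\<close>

definition DPR1 :: "'a::{semiring_1,conjugate} mat \<Rightarrow> 'a vec \<Rightarrow> 'a vec \<Rightarrow> 'a \<Rightarrow> 'a mat" where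
  "DPR1 \<Delta> x y \<rho> = \<Delta> + mat (dim_vec x) (dim_vec y) (\<lambda>(i, k). x $ i * \<rho> * conjugate (y $ k))"

text \<open>Indices run from 0: \<open>(P a)\<^sub>k = a\<^bsub>p k\<^esub>\<close> for \<open>k < n\<close>.\<close>

definition perm_mat :: "nat \<Rightarrow> (nat \<Rightarrow> nat) \<Rightarrow> 'a::{zero,one} mat" where
  "perm_mat n p = mat n n (\<lambda>(k, l). if l = p k then 1 else 0)"

text \<open>The list \<open>(0, \<dots>, j - 1, n - 1, j, \<dots>, n - 2)\<close>, as a function on \<open>{..<n}\<close>.\<close>

definition tip_perm :: "nat \<Rightarrow> nat \<Rightarrow> nat \<Rightarrow> nat" where
  "tip_perm n j k = (if k < j then k else if k = j then n - 1 else k - 1)"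

text \<open>The block matrix with rows \<open>(D, u)\<close> and \<open>(v\<^sup>\<star>, \<alpha>)\<close>.\<close>

definition arrow_block :: "'a::conjugate mat \<Rightarrow> 'a vec \<Rightarrow> 'a vec \<Rightarrow> 'a \<Rightarrow> 'a mat" where
  "arrow_block D u v \<alpha> = four_block_mat
     D                                      (mat_of_cols (dim_vec u) [u])
     (mat_of_rows (dim_vec v) [conjugate v])  (mat 1 1 (\<lambda>_. \<alpha>))"

text \<open>Since \<open>(P M P\<^sup>T)\<^bsub>k l\<^esub> = M\<^bsub>p k, p l\<^esub>\<close>, the entry \<open>\<alpha>\<close> of the block matrix, which sits at
  \<open>(n - 1, n - 1)\<close>, is moved to \<open>(j, j)\<close> exactly if \<open>p j = n - 1\<close>.\<close>

definition arrowhead_with_tip :: "nat \<Rightarrow> nat \<Rightarrow> 'a::{semiring_1,conjugate} mat \<Rightarrow> bool" where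
  "arrowhead_with_tip n j A \<longleftrightarrow> j < n \<and>
     (\<exists>D u v \<alpha> p. D \<in> carrier_mat (n - 1) (n - 1) \<and> diagonal_mat D \<and>
        u \<in> carrier_vec (n - 1) \<and> v \<in> carrier_vec (n - 1) \<and>
        p permutes {..<n} \<and> p j = n - 1 \<and>
        A = perm_mat n p * arrow_block D u v \<alpha> * transpose_mat (perm_mat n p))"

end

theory Submission
  imports Defs
begin

text \<open>Row \<open>i\<close> of \<open>A C\<close> is \<open>\<delta>\<^sub>i\<close> times row \<open>i\<close> of \<open>C\<close> plus \<open>x\<^sub>i \<rho>\<close> times the row vector \<open>y\<^sup>\<star> C\<close>, so
  the claimed inverse \<open>C\<close> is verified entrywise once \<open>y\<^sup>\<star> C\<close> is known; since \<open>A\<close> is invertible,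
  the one-sided identity \<open>A C = 1\<close> suffices. The scalars that are inverted are non-zero because of
  the invertibility of \<open>A\<close>: if \<open>\<delta>\<^sub>j = 0\<close> then row \<open>j\<close> of \<open>A\<close> is \<open>x\<^sub>j \<rho> y\<^sup>\<star>\<close> and column \<open>j\<close> is
  \<open>x \<rho> y\<^sub>j\<^sup>\<star>\<close>, neither of which vanishes, and a second zero on the diagonal would give two
  linearly dependent rows.\<close>

section \<open>Conjugation\<close>

lemma quat_conjugate:
  fixes a b :: quat
  shows "conjugate (a + b) = conjugate a + conjugate b"
    and "conjugate (a * b) = conjugate b * conjugate a"
  by (simp_all add: quat_eq_iff conjugate_quat_def plus_quat_def times_quat_def algebra_simps)

text \<open>The class only makes conjugation an involution. Both sides of each law have the same
  image under \<open>f\<close>, so injectivity pulls the law back from the model to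
  \<open>'a\<close>.\<close>

lemma star_iso_conjugate:
  fixes f :: "'a::star_division_ring \<Rightarrow> 'b::star_division_ring" and a b :: 'a
  assumes f: "star_iso f"
    and add: "\<And>a b :: 'b. conjugate (a + b) = conjugate a + conjugate b"
    and mult: "\<And>a b :: 'b. conjugate (a * b) = conjugate b * conjugate a"
  shows "conjugate (a + b) = conjugate a + conjugate b"
    and "conjugate (a * b) = conjugate b * conjugate a"
proof -
  have "inj f" and hom: "\<And>a b. f (a + b) = f a + f b" "\<And>a b. f (a * b) = f a * f b"
      "\<And>a. f (conjugate a) = conjugate (f a)"
    using f by (auto simp: star_iso_def bij_def)
  have "f (conjugate (a + b)) = f (conjugate a + conjugate b)"
    and "f (conjugate (a * b)) = f (conjugate b * conjugate a)"
    by (simp_all add: hom add mult)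
  with \<open>inj f\<close> show "conjugate (a + b) = conjugate a + conjugate b"
    and "conjugate (a * b) = conjugate b * conjugate a"
    by (auto dest: injD)
qed

text \<open>One of the three models is available, and each satisfies both laws. The reversed order
  of the factors is essential for quaternions; in the other two models multiplication
  commutes.\<close>

lemma conjugate_plus: "conjugate (a + b) = conjugate a + conjugate b"
  and conjugate_times: "conjugate (a * b) = conjugate b * conjugate a"
  for a b :: "'a::real_complex_quat"
proof -
  have "conjugate (a + b) = conjugate a + conjugate b \<and>
      conjugate (a * b) = conjugate b * conjugate a"
    using real_complex_or_quat[where 'a = 'a]
  proof (elim disjE exE)
    fix f :: "'a \<Rightarrow> real"
    assume "star_iso f"
    from star_iso_conjugate[OF this, of a b] show ?thesis by simp
  next
    fix f :: "'a \<Rightarrow> complex"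
    assume "star_iso f"
    from star_iso_conjugate[OF this, of a b] show ?thesis by simp
  next
    fix f :: "'a \<Rightarrow> quat"
    assume "star_iso f"
    from star_iso_conjugate[OF this, of a b] show ?thesis by (simp add: quat_conjugate)
  qed
  then show "conjugate (a + b) = conjugate a + conjugate b"
    and "conjugate (a * b) = conjugate b * conjugate a" by auto
qed

lemma conjugate_0 [simp]: "conjugate (0 :: 'a::real_complex_quat) = 0"
  using conjugate_plus[of 0 "0 :: 'a"] by simp

lemma conjugate_eq_0_iff [simp]: "conjugate a = 0 \<longleftrightarrow> a = 0" for a :: "'a::real_complex_quat"
  using conjugate_cancel_iff[of a 0] by simp

lemma conjugate_1 [simp]: "conjugate (1 :: 'a::real_complex_quat) = 1"
  \<comment> \<open>With \<open>conjugate 1\<close> as first factor the involution turns the product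
    law into \<open>1 = conjugate 1 * 1\<close>.\<close>
  using conjugate_times[of "conjugate 1" "1 :: 'a"] by simp

lemma conjugate_uminus: "conjugate (- a) = - conjugate a" for a :: "'a::real_complex_quat"
  using conjugate_plus[of a "- a"] by (simp add: eq_neg_iff_add_eq_0 add.commute)

lemma conjugate_inverse: "conjugate (inverse a) = inverse (conjugate a)"
  for a :: "'a::real_complex_quat"
proof (cases "a = 0")
  case False
  then have "conjugate a * conjugate (inverse a) = 1"
    by (simp flip: conjugate_times)
  then show ?thesis by (simp add: inverse_unique)
qed simp


section \<open>Matrix inverses over a ring\<close>

lemma index_mult_mat_sum:
  fixes A B :: "'a::semiring_0 mat"
  assumes "A \<in> carrier_mat n m" "B \<in> carrier_mat m k" "i < n" "j < k"
  shows "(A * B) $$ (i, j) = (\<Sum>l<m. A $$ (i, l) * B $$ (l, j))"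
  using assms by (auto simp: scalar_prod_def atLeast0LessThan intro!: sum.cong)

text \<open>For the chosen two-sided inverse \<open>C\<close>, associativity gives
  \<open>C = C * (A * B) = (C * A) * B = B\<close>. Thus checking one product identifies the value
  picked by \<open>SOME\<close>.\<close>

lemma mat_inv_eqI:
  fixes A B :: "'a::ring_1 mat"
  assumes A: "A \<in> carrier_mat n n" and B: "B \<in> carrier_mat n n"
    and AB: "A * B = 1\<^sub>m n" and inv: "invertible_mat A"
  shows "mat_inv A = B"
proof -
  have "\<exists>C. inverts_mat A C \<and> inverts_mat C A"
    using inv by (simp add: invertible_mat_def)
  then have *: "inverts_mat A (mat_inv A)" "inverts_mat (mat_inv A) A"
    unfolding mat_inv_def by (metis (mono_tags, lifting) someI_ex)+
  let ?C = "mat_inv A"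
  \<comment> \<open>\<open>inverts_mat\<close> does not fix the shape of \<open>?C\<close>: its
    column count is read off from the identity \<open>A * ?C\<close>, its row count from the
    identity \<open>?C * A\<close>.\<close>
  have "dim_row (A * ?C) = n" "dim_col (A * ?C) = n" "dim_col (?C * A) = dim_row ?C"
    using * A by (simp_all add: inverts_mat_def)
  then have C: "?C \<in> carrier_mat n n" using A by auto
  then have "?C * A = 1\<^sub>m n" using * by (simp add: inverts_mat_def)
  then have "?C * (A * B) = B"
    using assoc_mult_mat[OF C A B] B by simp
  then show ?thesis using AB C by simp
qed

lemma invertible_matE:
  fixes A :: "'a::ring_1 mat"
  assumes "A \<in> carrier_mat n n" "invertible_mat A"
  obtains B where "B \<in> carrier_mat n n" "A * B = 1\<^sub>m n" "B * A = 1\<^sub>m n"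
proof -
  obtain B where *: "inverts_mat A B" "inverts_mat B A"
    using assms by (auto simp: invertible_mat_def)
  have "dim_col (A * B) = n" "dim_col (B * A) = dim_row B"
    using * assms by (simp_all add: inverts_mat_def)
  then have "B \<in> carrier_mat n n" using assms by auto
  with * that[of B] assms show thesis by (simp add: inverts_mat_def)
qed

lemma invertible_matI:
  fixes A B :: "'a::ring_1 mat"
  assumes "A \<in> carrier_mat n n" "B \<in> carrier_mat n n" "A * B = 1\<^sub>m n" "B * A = 1\<^sub>m n"
  shows "invertible_mat A"
  using assms by (auto simp: invertible_mat_def inverts_mat_def intro!: exI[of _ B])

text \<open>Replaces the choice in \<open>mat_inv\<close> by explicit entries. Each sum in the two
  products has a single term that can be non-zero; both products are checked because invertibility
  itself is claimed.\<close>

lemma diagonal_mat_inverse: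
  fixes D :: "'a::division_ring mat"
  assumes D: "D \<in> carrier_mat n n" "diagonal_mat D"
    and nz: "\<And>i. i < n \<Longrightarrow> D $$ (i, i) \<noteq> 0"
  shows "invertible_mat D"
    and "mat_inv D = mat n n (\<lambda>(i, k). if i = k then inverse (D $$ (i, i)) else 0)"
proof -
  let ?E = "mat n n (\<lambda>(i, k). if i = k then inverse (D $$ (i, i)) else 0)"
  have D': "D $$ (i, k) = 0" if "i < n" "k < n" "i \<noteq> k" for i k
    using D that by (auto simp: diagonal_mat_def)
  have E: "?E \<in> carrier_mat n n" by simp
  have DE: "D * ?E = 1\<^sub>m n"
  proof (rule eq_matI)
    fix i k assume "i < dim_row (1\<^sub>m n :: 'a mat)" "k < dim_col (1\<^sub>m n :: 'a mat)"
    then have ik: "i < n" "k < n" by auto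
    have "(D * ?E) $$ (i, k) = (\<Sum>l<n. D $$ (i, l) * ?E $$ (l, k))"
      using index_mult_mat_sum[OF D(1) E ik] .
    also have "\<dots> = (\<Sum>l<n. if l = i then D $$ (i, i) * ?E $$ (i, k) else 0)"
      using ik by (intro sum.cong) (auto simp: D')
    finally show "(D * ?E) $$ (i, k) = 1\<^sub>m n $$ (i, k)"
      using ik nz by auto
  qed (use D in auto)
  have ED: "?E * D = 1\<^sub>m n"
  proof (rule eq_matI)
    fix i k assume "i < dim_row (1\<^sub>m n :: 'a mat)" "k < dim_col (1\<^sub>m n :: 'a mat)"
    then have ik: "i < n" "k < n" by auto
    have "(?E * D) $$ (i, k) = (\<Sum>l<n. ?E $$ (i, l) * D $$ (l, k))"
      using index_mult_mat_sum[OF E D(1) ik] .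
    also have "\<dots> = (\<Sum>l<n. if l = i then ?E $$ (i, i) * D $$ (i, k) else 0)"
      using ik by (intro sum.cong) auto
    finally show "(?E * D) $$ (i, k) = 1\<^sub>m n $$ (i, k)"
      using ik nz by (auto simp: D')
  qed (use D in auto)
  show inv: "invertible_mat D" using invertible_matI[OF D(1) E DE ED] .
  show "mat_inv D = ?E" using mat_inv_eqI[OF D(1) E DE inv] .
qed

lemma mat_inv_diagonal_mult_vec:
  fixes D :: "'a::division_ring mat"
  assumes D: "D \<in> carrier_mat n n" "diagonal_mat D"
    and nz: "\<And>i. i < n \<Longrightarrow> D $$ (i, i) \<noteq> 0"
    and v: "v \<in> carrier_vec n"
  shows "mat_inv D *\<^sub>v v = vec n (\<lambda>i. inverse (D $$ (i, i)) * v $ i)"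
proof (rule eq_vecI)
  fix i assume "i < dim_vec (vec n (\<lambda>i. inverse (D $$ (i, i)) * v $ i))"
  then have i: "i < n" by simp
  have "(mat_inv D *\<^sub>v v) $ i = (\<Sum>l<n. (if i = l then inverse (D $$ (i, i)) else 0) * v $ l)"
    using i v by (simp add: diagonal_mat_inverse(2)[OF D nz] scalar_prod_def atLeast0LessThan)
  also have "\<dots> = (\<Sum>l<n. if l = i then inverse (D $$ (i, i)) * v $ i else 0)"
    by (intro sum.cong) auto
  finally show "(mat_inv D *\<^sub>v v) $ i = vec n (\<lambda>i. inverse (D $$ (i, i)) * v $ i) $ i"
    using i by simp
qed (simp add: diagonal_mat_inverse(2)[OF D nz])

lemma mat_star_mat_inv_diagonal_mult_vec:
  fixes D :: "'a::real_complex_quat mat"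
  assumes D: "D \<in> carrier_mat n n" "diagonal_mat D"
    and nz: "\<And>i. i < n \<Longrightarrow> D $$ (i, i) \<noteq> 0"
    and v: "v \<in> carrier_vec n"
  shows "mat_star (mat_inv D) *\<^sub>v v = vec n (\<lambda>i. conjugate (inverse (D $$ (i, i))) * v $ i)"
proof (rule eq_vecI)
  fix i assume "i < dim_vec (vec n (\<lambda>i. conjugate (inverse (D $$ (i, i))) * v $ i))"
  then have i: "i < n" by simp
  have "(mat_star (mat_inv D) *\<^sub>v v) $ i =
      (\<Sum>l<n. conjugate (if i = l then inverse (D $$ (i, i)) else 0) * v $ l)"
    using i v by (auto simp: diagonal_mat_inverse(2)[OF D nz] scalar_prod_def atLeast0LessThan
        mat_star_def intro!: sum.cong)
  also have "\<dots> = (\<Sum>l<n. if l = i then conjugate (inverse (D $$ (i, i))) * v $ i else 0)"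
    by (intro sum.cong) auto
  finally show "(mat_star (mat_inv D) *\<^sub>v v) $ i =
      vec n (\<lambda>i. conjugate (inverse (D $$ (i, i))) * v $ i) $ i"
    using i by simp
qed (simp add: diagonal_mat_inverse(2)[OF D nz] mat_star_def)


section \<open>Inverses of diagonal-plus-rank-one matrices\<close>

text \<open>Serves the last row of the arrow block: it holds the conjugates of the entries of
  \<open>v\<close>, and conjugation reverses the three factors.\<close>

lemma conjugate_uminus_times_times:
  "conjugate (- (conjugate (inverse d) * y * inverse c)) =
    - (inverse (conjugate c) * conjugate y * inverse d)"
  for c d y :: "'a::real_complex_quat"
  by (simp add: conjugate_uminus conjugate_times conjugate_inverse mult.assoc)

locale dpr1 =
  fixes n :: nat and \<Delta> :: "'a::real_complex_quat mat" and x y :: "'a vec" and \<rho> :: 'a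
  assumes \<Delta>: "\<Delta> \<in> carrier_mat n n" "diagonal_mat \<Delta>"
    and x: "x \<in> carrier_vec n" and y: "y \<in> carrier_vec n"
    and invertible: "invertible_mat (DPR1 \<Delta> x y \<rho>)"
begin

section \<open>Entries of \<open>A\<close> and of products with \<open>A\<close>\<close>

abbreviation "A \<equiv> DPR1 \<Delta> x y \<rho>"

abbreviation "\<delta> i \<equiv> \<Delta> $$ (i, i)"

lemma A_carrier: "A \<in> carrier_mat n n"
  using \<Delta> x y by (simp add: DPR1_def)

lemma A_index:
  "i < n \<Longrightarrow> k < n \<Longrightarrow>
    A $$ (i, k) = (if i = k then \<delta> i else 0) + x $ i * \<rho> * conjugate (y $ k)"
  using \<Delta> x y by (auto simp: DPR1_def diagonal_mat_def)

text \<open>The diagonal part leaves the term \<open>l = i\<close>, and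
  \<open>x $ i * \<rho>\<close> is a common left factor of the rest, so no factors are
  interchanged.\<close>

lemma A_mult_index:
  assumes C: "C \<in> carrier_mat n n" and ik: "i < n" "k < n"
  shows "(A * C) $$ (i, k) =
    \<delta> i * C $$ (i, k) + x $ i * \<rho> * (\<Sum>l<n. conjugate (y $ l) * C $$ (l, k))"
proof -
  have "(A * C) $$ (i, k) = (\<Sum>l<n. A $$ (i, l) * C $$ (l, k))"
    using index_mult_mat_sum[OF A_carrier C ik] .
  also have "\<dots> = (\<Sum>l<n. (if l = i then \<delta> i * C $$ (i, k) else 0) +
      x $ i * \<rho> * (conjugate (y $ l) * C $$ (l, k)))"
    using ik by (intro sum.cong) (auto simp: A_index algebra_simps)
  also have "\<dots> = \<delta> i * C $$ (i, k) + x $ i * \<rho> * (\<Sum>l<n. conjugate (y $ l) * C $$ (l, k))"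
    using ik by (simp add: sum.distrib sum_distrib_left)
  finally show ?thesis .
qed

text \<open>Mirror image for products from the other side, where
  \<open>\<rho> * conjugate (y $ k)\<close> is the common right factor. It gives access to
  \<open>y $ j\<close> when \<open>\<delta> j = 0\<close>.\<close>

lemma mult_A_index:
  assumes C: "C \<in> carrier_mat n n" and ik: "i < n" "k < n"
  shows "(C * A) $$ (i, k) =
    C $$ (i, k) * \<delta> k + (\<Sum>l<n. C $$ (i, l) * x $ l) * \<rho> * conjugate (y $ k)"
proof -
  have "(C * A) $$ (i, k) = (\<Sum>l<n. C $$ (i, l) * A $$ (l, k))"
    using index_mult_mat_sum[OF C A_carrier ik] .
  also have "\<dots> = (\<Sum>l<n. (if l = k then C $$ (i, k) * \<delta> k else 0) +
      C $$ (i, l) * x $ l * \<rho> * conjugate (y $ k))"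
    using ik by (intro sum.cong) (auto simp: A_index algebra_simps)
  also have "\<dots> = C $$ (i, k) * \<delta> k + (\<Sum>l<n. C $$ (i, l) * x $ l) * \<rho> * conjugate (y $ k)"
    using ik by (simp add: sum.distrib sum_distrib_right)
  finally show ?thesis .
qed

text \<open>Reduces both inverse formulas to scalar identities. The sum is entry \<open>k\<close> of
  the row vector \<open>y\<^sup>\<star> C\<close>, the only quantity that couples different rows of
  \<open>C\<close>.\<close>

lemma mat_inv_A_eqI:
  assumes "C \<in> carrier_mat n n"
    and "\<And>i k. i < n \<Longrightarrow> k < n \<Longrightarrow>
      \<delta> i * C $$ (i, k) + x $ i * \<rho> * (\<Sum>l<n. conjugate (y $ l) * C $$ (l, k)) =
      (if i = k then 1 else 0)"
  shows "mat_inv A = C"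
  using assms A_carrier
  by (intro mat_inv_eqI[OF A_carrier _ eq_matI invertible])
    (auto simp: A_mult_index simp del: index_mult_mat(1))

text \<open>At position \<open>(j, j)\<close> the diagonal part contributes nothing, so the entry 1
  of \<open>A * B\<close> is a product containing \<open>x $ j\<close> and \<open>\<rho>\<close>,
  and that of \<open>B * A\<close> one containing \<open>conjugate (y $ j)\<close>.\<close>

lemma nondegenerate:
  assumes j: "j < n" "\<delta> j = 0"
  shows "x $ j \<noteq> 0" and "y $ j \<noteq> 0" and "\<rho> \<noteq> 0"
    and "i < n \<Longrightarrow> i \<noteq> j \<Longrightarrow> \<delta> i \<noteq> 0"
proof -
  obtain B where B: "B \<in> carrier_mat n n" "A * B = 1\<^sub>m n" "B * A = 1\<^sub>m n"
    using invertible_matE[OF A_carrier invertible] .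
  have "x $ j * \<rho> * (\<Sum>l<n. conjugate (y $ l) * B $$ (l, j)) = 1"
    using A_mult_index[OF B(1) j(1) j(1)] B(2) j by simp
  then show xj: "x $ j \<noteq> 0" and \<rho>: "\<rho> \<noteq> 0" by auto
  have "(\<Sum>l<n. B $$ (j, l) * x $ l) * \<rho> * conjugate (y $ j) = 1"
    using mult_A_index[OF B(1) j(1) j(1)] B(3) j by simp
  then show "y $ j \<noteq> 0" by auto
  assume i: "i < n" "i \<noteq> j"
  \<comment> \<open>With a second zero at \<open>i\<close>, the same \<open>?s\<close> governs two
    entries of column \<open>i\<close> of \<open>A * B\<close>: the diagonal one forces
    \<open>?s\<close> to be non-zero, the one in row \<open>j\<close> forces it to vanish.\<close>
  let ?s = "\<Sum>l<n. conjugate (y $ l) * B $$ (l, i)"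
  show "\<delta> i \<noteq> 0"
  proof
    assume "\<delta> i = 0"
    then have "x $ i * \<rho> * ?s = 1"
      using A_mult_index[OF B(1) i(1) i(1)] B(2) i by simp
    moreover have "x $ j * \<rho> * ?s = 0"
      using A_mult_index[OF B(1) j(1) i(1)] B(2) i j by simp
    ultimately show False using xj \<rho> by auto
  qed
qed

lemma regular_nonzero:
  assumes nz: "\<And>i. i < n \<Longrightarrow> \<delta> i \<noteq> 0"
  shows "1 + (\<Sum>l<n. conjugate (y $ l) * (inverse (\<delta> l) * x $ l)) * \<rho> \<noteq> 0"
proof
  let ?s = "\<Sum>l<n. conjugate (y $ l) * (inverse (\<delta> l) * x $ l)"
  assume zero: "1 + ?s * \<rho> = 0"
  obtain B where B: "B \<in> carrier_mat n n" "A * B = 1\<^sub>m n"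
    using invertible_matE[OF A_carrier invertible] .
  \<comment> \<open>The row vector \<open>y\<^sup>\<star> \<Delta>\<^sup>-\<^sup>1\<close> would be a left null vector of \<open>A\<close>, since
    \<open>y\<^sup>\<star> \<Delta>\<^sup>-\<^sup>1 A = (1 + y\<^sup>\<star> \<Delta>\<^sup>-\<^sup>1 x \<rho>) y\<^sup>\<star>\<close>.\<close>
  have "conjugate (y $ k) * inverse (\<delta> k) = 0" if k: "k < n" for k
  proof -
    let ?t = "\<Sum>l<n. conjugate (y $ l) * B $$ (l, k)"
    have "(\<Sum>i<n. conjugate (y $ i) * inverse (\<delta> i) * (A * B) $$ (i, k)) =
        (\<Sum>i<n. conjugate (y $ i) * B $$ (i, k) +
          conjugate (y $ i) * (inverse (\<delta> i) * x $ i) * \<rho> * ?t)"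
    proof (intro sum.cong refl)
      fix i assume "i \<in> {..<n}"
      then have i: "i < n" by simp
      have "inverse (\<delta> i) * (\<delta> i * B $$ (i, k)) = B $$ (i, k)"
        using nz[OF i] by (simp flip: mult.assoc)
      then show "conjugate (y $ i) * inverse (\<delta> i) * (A * B) $$ (i, k) =
          conjugate (y $ i) * B $$ (i, k) +
          conjugate (y $ i) * (inverse (\<delta> i) * x $ i) * \<rho> * ?t"
        unfolding A_mult_index[OF B(1) i k] by (simp add: distrib_left mult.assoc)
    qed
    also have "\<dots> = (1 + ?s * \<rho>) * ?t"
      by (simp add: sum.distrib distrib_right sum_distrib_right)
    also have "\<dots> = 0" by (simp add: zero)
    \<comment> \<open>The same combination of rows is now evaluated through
      \<open>A * B = 1\<close>, which leaves only the coefficient of row \<open>k\<close>.\<close>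
    finally have "0 = (\<Sum>i<n. conjugate (y $ i) * inverse (\<delta> i) * (A * B) $$ (i, k))" by simp
    also have "\<dots> = (\<Sum>i<n. if i = k then conjugate (y $ k) * inverse (\<delta> k) else 0)"
      using k B(2) by (intro sum.cong) auto
    finally show ?thesis using k by simp
  qed
  \<comment> \<open>A zero row vector makes \<open>?s\<close> vanish, and then \<open>zero\<close>
    reads \<open>1 = 0\<close>.\<close>
  then have "?s = 0"
    using nz by (intro sum.neutral) auto
  with zero show False by simp
qed

text \<open>The Sherman-Morrison formula over a skew field. With a scalar \<open>r\<close> in the
  rank-one term of the candidate, everything in \<open>A * C\<close> beyond the identity carries the
  factor \<open>r + \<rho> * (1 + s * r)\<close>, which the stated \<open>r\<close> makes
  zero.\<close>

lemma inverse_regular: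
  assumes nz: "\<And>i. i < n \<Longrightarrow> \<delta> i \<noteq> 0"
  defines "s \<equiv> y \<star>\<bullet> (mat_inv \<Delta> *\<^sub>v x)"
  shows "1 + s * \<rho> \<noteq> 0"
    and "mat_inv A = DPR1 (mat_inv \<Delta>) (mat_inv \<Delta> *\<^sub>v x) (mat_star (mat_inv \<Delta>) *\<^sub>v y)
      (- \<rho> * inverse (1 + s * \<rho>))"
proof -
  note inv = diagonal_mat_inverse(2)[OF \<Delta> nz] mat_inv_diagonal_mult_vec[OF \<Delta> nz x]
    mat_star_mat_inv_diagonal_mult_vec[OF \<Delta> nz y]
  have s: "s = (\<Sum>l<n. conjugate (y $ l) * (inverse (\<delta> l) * x $ l))"
    using y by (simp add: s_def inv(2) star_prod_def scalar_prod_def atLeast0LessThan)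
  show nz': "1 + s * \<rho> \<noteq> 0"
    using regular_nonzero[OF nz] by (simp add: s)
  define r where "r = - \<rho> * inverse (1 + s * \<rho>)"
  have r: "r + \<rho> * (1 + s * r) = 0"
  proof -
    have "r + \<rho> * (1 + s * r) = \<rho> + (1 + \<rho> * s) * r"
      by (simp add: algebra_simps)
    \<comment> \<open>Rests on \<open>(1 + \<rho> * s) * \<rho> = \<rho> * (1 + s * \<rho>)\<close>,
      which brings the inverted scalar next to its inverse without commuting \<open>\<rho>\<close>
      and \<open>s\<close>.\<close>
    also have "\<dots> = \<rho> - \<rho> * ((1 + s * \<rho>) * inverse (1 + s * \<rho>))"
      by (simp add: r_def algebra_simps)
    finally show ?thesis using nz' by simp
  qed
  let ?C = "DPR1 (mat_inv \<Delta>) (mat_inv \<Delta> *\<^sub>v x) (mat_star (mat_inv \<Delta>) *\<^sub>v y) r"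
  have C_index: "?C $$ (i, k) = (if i = k then inverse (\<delta> i) else 0) +
      inverse (\<delta> i) * x $ i * r * (conjugate (y $ k) * inverse (\<delta> k))"
    if "i < n" "k < n" for i k
    using that by (simp add: DPR1_def inv(2,3) conjugate_times) (simp add: inv(1))
  have "mat_inv A = ?C"
  proof (rule mat_inv_A_eqI)
    show "?C \<in> carrier_mat n n" by (simp add: DPR1_def inv(2,3))
    fix i k assume ik: "i < n" "k < n"
    \<comment> \<open>\<open>?w\<close> is entry \<open>k\<close> of
      \<open>y\<^sup>\<star> \<Delta>\<^sup>-\<^sup>1\<close>. It comes both from the diagonal part
      of \<open>?C\<close> and, as the conjugated last factor, from its rank-one part.\<close>
    let ?w = "conjugate (y $ k) * inverse (\<delta> k)"
    have "(\<Sum>l<n. conjugate (y $ l) * ?C $$ (l, k)) =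
        (\<Sum>l<n. (if l = k then ?w else 0) +
          conjugate (y $ l) * (inverse (\<delta> l) * x $ l) * r * ?w)"
      using ik by (intro sum.cong) (auto simp: C_index distrib_left mult.assoc)
    also have "\<dots> = (1 + s * r) * ?w"
      using ik by (simp add: sum.distrib distrib_right s sum_distrib_right)
    finally have *: "(\<Sum>l<n. conjugate (y $ l) * ?C $$ (l, k)) = (1 + s * r) * ?w" .
    have "\<delta> i * ?C $$ (i, k) = (if i = k then 1 else 0) + x $ i * r * ?w"
      using ik nz by (simp add: C_index distrib_left flip: mult.assoc)
    then have "\<delta> i * ?C $$ (i, k) + x $ i * \<rho> * (\<Sum>l<n. conjugate (y $ l) * ?C $$ (l, k)) =
        (if i = k then 1 else 0) + x $ i * (r + \<rho> * (1 + s * r)) * ?w"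
      unfolding * by (simp add: algebra_simps)
    then show "\<delta> i * ?C $$ (i, k) + x $ i * \<rho> * (\<Sum>l<n. conjugate (y $ l) * ?C $$ (l, k)) =
        (if i = k then 1 else 0)"
      by (simp add: r)
  qed
  then show "mat_inv A = DPR1 (mat_inv \<Delta>) (mat_inv \<Delta> *\<^sub>v x) (mat_star (mat_inv \<Delta>) *\<^sub>v y)
      (- \<rho> * inverse (1 + s * \<rho>))"
    by (simp add: r_def)
qed

text \<open>The arrowhead in the index order of \<open>A\<close>, before any permutation. It works
  because \<open>y\<^sup>\<star> C\<close> vanishes except at position \<open>j\<close>, where it
  equals \<open>inverse \<rho> * inverse (x $ j)\<close>.\<close>

lemma inverse_singular:
  assumes j: "j < n" "\<delta> j = 0"
  shows "mat_inv A = mat n n (\<lambda>(i, k).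
    if i = j then
      if k = j then
        inverse (conjugate (y $ j)) *
          (inverse \<rho> + (\<Sum>l\<in>{..<n} - {j}. conjugate (y $ l) * (inverse (\<delta> l) * x $ l))) *
          inverse (x $ j)
      else - (inverse (conjugate (y $ j)) * conjugate (y $ k) * inverse (\<delta> k))
    else
      if k = j then - (inverse (\<delta> i) * x $ i) * inverse (x $ j)
      else if i = k then inverse (\<delta> i) else 0)" (is "_ = ?C")
proof (rule mat_inv_A_eqI)
  note nd = nondegenerate[OF j]
  show "?C \<in> carrier_mat n n" by simp
  fix i k assume ik: "i < n" "k < n"
  let ?t = "\<Sum>l\<in>{..<n} - {j}. conjugate (y $ l) * (inverse (\<delta> l) * x $ l)"
  have split: "(\<Sum>l<n. conjugate (y $ l) * ?C $$ (l, k)) =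
      conjugate (y $ j) * ?C $$ (j, k) + (\<Sum>l\<in>{..<n} - {j}. conjugate (y $ l) * ?C $$ (l, k))"
    using j by (intro sum.remove) auto
  show "\<delta> i * ?C $$ (i, k) + x $ i * \<rho> * (\<Sum>l<n. conjugate (y $ l) * ?C $$ (l, k)) =
      (if i = k then 1 else 0)"
  proof (cases "k = j")
    case True
    have "(\<Sum>l\<in>{..<n} - {j}. conjugate (y $ l) * ?C $$ (l, k)) = - ?t * inverse (x $ j)"
      using ik True by (simp add: sum_distrib_right sum_negf mult.assoc)
    moreover have "conjugate (y $ j) * ?C $$ (j, k) = (inverse \<rho> + ?t) * inverse (x $ j)"
      using ik True nd by (simp flip: mult.assoc)
    ultimately have "(\<Sum>l<n. conjugate (y $ l) * ?C $$ (l, k)) = inverse \<rho> * inverse (x $ j)"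
      unfolding split by (simp add: algebra_simps)
    \<comment> \<open>In column \<open>j\<close> the rank-one part contributes
      \<open>x $ i * inverse (x $ j)\<close>: this is 1 in row \<open>j\<close>, and
      \<open>\<delta> i * ?C $$ (i, j)\<close> cancels it in the other rows.\<close>
    then have "x $ i * \<rho> * (\<Sum>l<n. conjugate (y $ l) * ?C $$ (l, k)) = x $ i * inverse (x $ j)"
      using nd by (simp add: mult.assoc) (simp flip: mult.assoc)
    moreover have "\<delta> i * ?C $$ (i, k) = (if i = j then 0 else - (x $ i * inverse (x $ j)))"
      using ik True nd(4)[of i] j by (simp flip: mult.assoc)
    ultimately show ?thesis using nd True by simp
  next
    case False
    have "(\<Sum>l\<in>{..<n} - {j}. conjugate (y $ l) * ?C $$ (l, k)) =
        (\<Sum>l\<in>{..<n} - {j}. if l = k then conjugate (y $ k) * inverse (\<delta> k) else 0)"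
      using ik False by (intro sum.cong) auto
    also have "\<dots> = conjugate (y $ k) * inverse (\<delta> k)"
      using ik False by simp
    \<comment> \<open>Row \<open>j\<close> of \<open>?C\<close> is designed for this cancellation;
      the rank-one part then drops out of column \<open>k\<close>.\<close>
    also have "\<dots> = - (conjugate (y $ j) * ?C $$ (j, k))"
      using ik False nd j by (simp flip: mult.assoc)
    finally have "(\<Sum>l<n. conjugate (y $ l) * ?C $$ (l, k)) = 0"
      unfolding split by simp
    then show ?thesis using ik False j nd(4)[of k] by simp
  qed
qed

end


section \<open>Arrowhead matrices\<close>

text \<open>Row \<open>k\<close> of the permutation matrix has its only 1 in column
  \<open>p k\<close>, so the sums for both multiplications have one surviving term.\<close>

lemma perm_mat_conj:
  fixes M :: "'a::semiring_1 mat"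
  assumes M: "M \<in> carrier_mat n n" and p: "\<And>k. k < n \<Longrightarrow> p k < n"
  shows "perm_mat n p * M * transpose_mat (perm_mat n p) = mat n n (\<lambda>(k, l). M $$ (p k, p l))"
proof (rule eq_matI)
  let ?P = "perm_mat n p :: 'a mat"
  have P: "?P \<in> carrier_mat n n" by (simp add: perm_mat_def)
  fix k l
  assume "k < dim_row (mat n n (\<lambda>(k, l). M $$ (p k, p l)))"
    "l < dim_col (mat n n (\<lambda>(k, l). M $$ (p k, p l)))"
  then have kl: "k < n" "l < n" by auto
  have PM: "(?P * M) $$ (k, i) = M $$ (p k, i)" if i: "i < n" for i
  proof -
    have "(?P * M) $$ (k, i) = (\<Sum>m<n. ?P $$ (k, m) * M $$ (m, i))"
      by (rule index_mult_mat_sum[OF P M kl(1) i])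
    also have "\<dots> = (\<Sum>m<n. if m = p k then M $$ (p k, i) else 0)"
      using kl by (intro sum.cong) (auto simp: perm_mat_def)
    finally show ?thesis using p kl by (simp del: index_mult_mat(1))
  qed
  have "(?P * M * transpose_mat ?P) $$ (k, l) =
      (\<Sum>m<n. (?P * M) $$ (k, m) * transpose_mat ?P $$ (m, l))"
    using P M kl by (intro index_mult_mat_sum) auto
  also have "\<dots> = (\<Sum>m<n. if m = p l then M $$ (p k, p l) else 0)"
    using kl by (intro sum.cong) (auto simp: PM simp del: index_mult_mat(1), auto simp: perm_mat_def)
  finally show "(?P * M * transpose_mat ?P) $$ (k, l) = mat n n (\<lambda>(k, l). M $$ (p k, p l)) $$ (k, l)"
    using p kl by simp
qed (simp_all add: perm_mat_def)

section \<open>The arrow block and the permutation that moves its tip\<close>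

lemma arrow_block_carrier:
  assumes "0 < n" "D \<in> carrier_mat (n - 1) (n - 1)" "u \<in> carrier_vec (n - 1)" "v \<in> carrier_vec (n - 1)"
  shows "arrow_block D u v \<alpha> \<in> carrier_mat n n"
  using assms by (auto simp: arrow_block_def)

lemma arrow_block_index:
  assumes "D \<in> carrier_mat (n - 1) (n - 1)" "u \<in> carrier_vec (n - 1)" "v \<in> carrier_vec (n - 1)"
    and "i < n" "k < n"
  shows "arrow_block D u v \<alpha> $$ (i, k) =
    (if i < n - 1 then if k < n - 1 then D $$ (i, k) else u $ i
     else if k < n - 1 then conjugate (v $ k) else \<alpha>)"
  using assms by (auto simp: arrow_block_def mat_of_cols_def mat_of_rows_def)

lemma tip_perm_less: "j < n \<Longrightarrow> k < n \<Longrightarrow> tip_perm n j k < n"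
  by (auto simp: tip_perm_def)

text \<open>\<open>permutes\<close> demands the identity outside \<open>{..<n}\<close>, where
  \<open>tip_perm\<close> would shift indices; hence the case distinction. Inside, an injective
  self-map of a finite set is onto.\<close>

lemma tip_perm_permutes:
  assumes j: "j < n"
  shows "(\<lambda>k. if k < n then tip_perm n j k else k) permutes {..<n}"
proof (rule bij_imp_permutes)
  have "inj_on (tip_perm n j) {..<n}"
    using j by (auto simp: inj_on_def tip_perm_def split: if_splits)
  moreover have "tip_perm n j ` {..<n} \<subseteq> {..<n}"
    using j by (auto simp: tip_perm_less)
  ultimately have "bij_betw (tip_perm n j) {..<n} {..<n}"
    by (simp add: bij_betw_def endo_inj_surj)
  then show "bij_betw (\<lambda>k. if k < n then tip_perm n j k else k) {..<n} {..<n}"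
    by (subst bij_betw_cong[where g = "tip_perm n j"]) auto
qed auto

text \<open>An arrowhead is recognised by its zero pattern: the four blocks are read off from
  \<open>C\<close> after moving row and column \<open>j\<close> to the end.\<close>

lemma arrowhead_with_tipI:
  fixes C :: "'a::{semiring_1,conjugate} mat"
  assumes C: "C \<in> carrier_mat n n" and j: "j < n"
    and zero: "\<And>i k. i < n \<Longrightarrow> k < n \<Longrightarrow> i \<noteq> j \<Longrightarrow> k \<noteq> j \<Longrightarrow> i \<noteq> k \<Longrightarrow> C $$ (i, k) = 0"
  shows "arrowhead_with_tip n j C"
proof -
  \<comment> \<open>\<open>q\<close> lists the indices other than \<open>j\<close> in increasing
    order and undoes \<open>p\<close> away from the tip. The conjugate in \<open>v\<close> below
    compensates for the one in \<open>arrow_block\<close>.\<close>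
  define q where "q i = (if i < j then i else Suc i)" for i
  define D where "D = mat (n - 1) (n - 1) (\<lambda>(i, k). C $$ (q i, q k))"
  define u where "u = vec (n - 1) (\<lambda>i. C $$ (q i, j))"
  define v where "v = vec (n - 1) (\<lambda>k. conjugate (C $$ (j, q k)))"
  define p where "p k = (if k < n then tip_perm n j k else k)" for k
  let ?M = "arrow_block D u v (C $$ (j, j))"
  have car: "D \<in> carrier_mat (n - 1) (n - 1)" "u \<in> carrier_vec (n - 1)" "v \<in> carrier_vec (n - 1)"
    by (simp_all add: D_def u_def v_def)
  have p: "p permutes {..<n}"
    using tip_perm_permutes[OF j] by (simp add: p_def[abs_def])
  have p_less: "p k < n" if "k < n" for k
    using that j by (simp add: p_def tip_perm_less)
  have q_p: "q (p k) = k" "p k < n - Suc 0" if "k < n" "k \<noteq> j" for k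
    using that j by (auto simp: p_def q_def tip_perm_def)
  have p_j: "p j = n - 1"
    using j by (simp add: p_def tip_perm_def)
  have "C = mat n n (\<lambda>(k, l). ?M $$ (p k, p l))"
  proof (rule eq_matI)
    fix k l
    assume "k < dim_row (mat n n (\<lambda>(k, l). ?M $$ (p k, p l)))"
      "l < dim_col (mat n n (\<lambda>(k, l). ?M $$ (p k, p l)))"
    then show "C $$ (k, l) = mat n n (\<lambda>(k, l). ?M $$ (p k, p l)) $$ (k, l)"
      by (cases "k = j"; cases "l = j")
        (simp_all add: arrow_block_index[OF car] p_less p_j q_p, simp_all add: D_def u_def v_def q_p)
  qed (use C in auto)
  also have "\<dots> = perm_mat n p * ?M * transpose_mat (perm_mat n p)"
    using j car by (intro perm_mat_conj[symmetric] arrow_block_carrier p_less) auto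
  finally have C_eq: "C = perm_mat n p * ?M * transpose_mat (perm_mat n p)" .
  have "diagonal_mat D"
    using j by (auto simp: diagonal_mat_def D_def q_def intro!: zero)
  then show ?thesis
    unfolding arrowhead_with_tip_def using j car p p_j C_eq by blast
qed

text \<open>Matches the single sum in the tip entry of the inverse with the two inner products over
  the blocks before and after \<open>j\<close>.\<close>

lemma sum_lessThan_remove:
  fixes f :: "nat \<Rightarrow> 'a::comm_monoid_add"
  assumes "j < n"
  shows "(\<Sum>l\<in>{..<n} - {j}. f l) = (\<Sum>l<j. f l) + (\<Sum>l<n - j - 1. f (Suc (j + l)))"
proof -
  have "{..<n} - {j} = {..<j} \<union> {Suc j..<n}" using assms by auto
  moreover have "(\<Sum>l\<in>{Suc j..<n}. f l) = (\<Sum>l<n - j - 1. f (Suc (j + l)))"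
    using assms
    by (intro sum.reindex_bij_witness[of _ "\<lambda>l. Suc (j + l)" "\<lambda>l. l - Suc j"]) auto
  moreover have "sum f ({..<j} \<union> {Suc j..<n}) = sum f {..<j} + sum f {Suc j..<n}"
    by (rule sum.union_disjoint) auto
  ultimately show ?thesis by simp
qed

section \<open>The inverse in block form when a diagonal entry vanishes\<close>

context dpr1
begin

lemma inverse_arrowhead:
  assumes "j < n" "\<delta> j = 0"
  shows "arrowhead_with_tip n j (mat_inv A)"
  by (rule arrowhead_with_tipI) (use assms in \<open>auto simp: inverse_singular[OF assms]\<close>)

text \<open>The block data are rewritten with the indices of \<open>\<Delta>\<close>,
  \<open>x\<close> and \<open>y\<close>; the permuted block matrix then agrees entry by entry with
  \<open>inverse_singular\<close>.\<close>

lemma inverse_arrow_block: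
  assumes j: "j < n" "\<delta> j = 0"
    and D1: "\<Delta>\<^sub>1 \<in> carrier_mat j j" and D2: "\<Delta>\<^sub>2 \<in> carrier_mat (n - j - 1) (n - j - 1)"
    and x1: "x\<^sub>1 \<in> carrier_vec j" and x2: "x\<^sub>2 \<in> carrier_vec (n - j - 1)"
    and y1: "y\<^sub>1 \<in> carrier_vec j" and y2: "y\<^sub>2 \<in> carrier_vec (n - j - 1)"
    and \<Delta>_eq: "\<Delta> = diag_block_mat [\<Delta>\<^sub>1, 0\<^sub>m 1 1, \<Delta>\<^sub>2]"
    and x_eq: "x = x\<^sub>1 @\<^sub>v vCons x\<^sub>j x\<^sub>2" and y_eq: "y = y\<^sub>1 @\<^sub>v vCons y\<^sub>j y\<^sub>2"
  defines "P \<equiv> perm_mat n (tip_perm n j)"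
    and "D \<equiv> diag_block_mat [mat_inv \<Delta>\<^sub>1, mat_inv \<Delta>\<^sub>2]"
    and "u \<equiv> (- (mat_inv \<Delta>\<^sub>1 *\<^sub>v x\<^sub>1) @\<^sub>v - (mat_inv \<Delta>\<^sub>2 *\<^sub>v x\<^sub>2)) \<cdot>\<^sub>r inverse x\<^sub>j"
    and "v \<equiv> (- (mat_star (mat_inv \<Delta>\<^sub>1) *\<^sub>v y\<^sub>1) @\<^sub>v - (mat_star (mat_inv \<Delta>\<^sub>2) *\<^sub>v y\<^sub>2))
      \<cdot>\<^sub>r inverse y\<^sub>j"
    and "\<alpha> \<equiv> conjugate (inverse y\<^sub>j) *
      (inverse \<rho> + (y\<^sub>1 \<star>\<bullet> (mat_inv \<Delta>\<^sub>1 *\<^sub>v x\<^sub>1)) + (y\<^sub>2 \<star>\<bullet> (mat_inv \<Delta>\<^sub>2 *\<^sub>v x\<^sub>2))) *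
      inverse x\<^sub>j"
  shows "invertible_mat \<Delta>\<^sub>1" and "invertible_mat \<Delta>\<^sub>2" and "x\<^sub>j \<noteq> 0" and "y\<^sub>j \<noteq> 0" and "\<rho> \<noteq> 0"
    and "mat_inv A = P * arrow_block D u v \<alpha> * transpose_mat P"
proof -
  note nd = nondegenerate[OF j]
  have x_index: "x $ j = x\<^sub>j" "\<And>i. i < j \<Longrightarrow> x $ i = x\<^sub>1 $ i"
      "\<And>i. i < n - j - 1 \<Longrightarrow> x $ Suc (j + i) = x\<^sub>2 $ i"
    using x1 x2 by (auto simp: x_eq vec_index_vCons)
  have y_index: "y $ j = y\<^sub>j" "\<And>i. i < j \<Longrightarrow> y $ i = y\<^sub>1 $ i"
      "\<And>i. i < n - j - 1 \<Longrightarrow> y $ Suc (j + i) = y\<^sub>2 $ i"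
    using y1 y2 by (auto simp: y_eq vec_index_vCons)
  have D1_index: "\<Delta>\<^sub>1 $$ (i, k) = \<Delta> $$ (i, k)" if "i < j" "k < j" for i k
    using that D1 D2 by (simp add: \<Delta>_eq Let_def)
  have D2_index: "\<Delta>\<^sub>2 $$ (i, k) = \<Delta> $$ (Suc (j + i), Suc (j + k))"
    if "i < n - j - 1" "k < n - j - 1" for i k
    using that D1 D2 by (simp add: \<Delta>_eq Let_def)
  have diag: "diagonal_mat \<Delta>\<^sub>1" "diagonal_mat \<Delta>\<^sub>2"
    using \<Delta> D1 D2 j by (auto simp: diagonal_mat_def D1_index D2_index)
  have nz1: "\<Delta>\<^sub>1 $$ (i, i) \<noteq> 0" if "i < j" for i
    using that j nd(4)[of i] by (simp add: D1_index)
  have nz2: "\<Delta>\<^sub>2 $$ (i, i) \<noteq> 0" if "i < n - j - 1" for i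
    using that j nd(4)[of "Suc (j + i)"] by (simp add: D2_index)
  show "invertible_mat \<Delta>\<^sub>1" "invertible_mat \<Delta>\<^sub>2"
    using diagonal_mat_inverse(1)[OF D1 diag(1) nz1] diagonal_mat_inverse(1)[OF D2 diag(2) nz2]
    by auto
  show "x\<^sub>j \<noteq> 0" "y\<^sub>j \<noteq> 0" "\<rho> \<noteq> 0" using nd by (simp_all add: x_index y_index)

  note inv1 = diagonal_mat_inverse(2)[OF D1 diag(1) nz1]
  note inv2 = diagonal_mat_inverse(2)[OF D2 diag(2) nz2]
  note inv_x1 = mat_inv_diagonal_mult_vec[OF D1 diag(1) nz1 x1]
  note inv_x2 = mat_inv_diagonal_mult_vec[OF D2 diag(2) nz2 x2]
  note star_y1 = mat_star_mat_inv_diagonal_mult_vec[OF D1 diag(1) nz1 y1]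
  note star_y2 = mat_star_mat_inv_diagonal_mult_vec[OF D2 diag(2) nz2 y2]
  \<comment> \<open>Position \<open>i\<close> of the concatenated blocks stands for index
    \<open>q i\<close> of \<open>A\<close>, which skips \<open>j\<close>. In the second block the
    local index is \<open>i - j\<close>, as \<open>q2\<close> records.\<close>
  define q where "q i = (if i < j then i else Suc i)" for i
  have q2: "q i = Suc (j + (i - j))" "i - j < n - j - 1" if "i < n - 1" "\<not> i < j" for i
    using that by (auto simp: q_def)
  have D: "D = mat (n - 1) (n - 1) (\<lambda>(i, k). if i = k then inverse (\<delta> (q i)) else 0)"
  proof (rule eq_matI)
    fix i k
    assume "i < dim_row (mat (n - 1) (n - 1) (\<lambda>(i, k). if i = k then inverse (\<delta> (q i)) else 0))"
      "k < dim_col (mat (n - 1) (n - 1) (\<lambda>(i, k). if i = k then inverse (\<delta> (q i)) else 0))"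
    then have ik: "i < n - 1" "k < n - 1" by auto
    then show "D $$ (i, k) =
        mat (n - 1) (n - 1) (\<lambda>(i, k). if i = k then inverse (\<delta> (q i)) else 0) $$ (i, k)"
      using j by (auto simp: D_def inv1 inv2 Let_def q_def D1_index D2_index)
  qed (use j in \<open>auto simp: D_def inv1 inv2 Let_def\<close>)
  have u: "u = vec (n - 1) (\<lambda>i. - (inverse (\<delta> (q i)) * x $ q i) * inverse (x $ j))"
  proof (rule eq_vecI)
    fix i assume "i < dim_vec (vec (n - 1) (\<lambda>i. - (inverse (\<delta> (q i)) * x $ q i) * inverse (x $ j)))"
    then have i: "i < n - 1" by simp
    show "u $ i = vec (n - 1) (\<lambda>i. - (inverse (\<delta> (q i)) * x $ q i) * inverse (x $ j)) $ i"
    proof (cases "i < j")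
      case True
      then show ?thesis using i j
        by (simp add: u_def smult_vec_right_def inv_x1 inv_x2 x_index D1_index q_def)
    next
      case False
      then show ?thesis using i j q2[OF i False] x_index(3)[of "i - j"]
        by (simp add: u_def smult_vec_right_def inv_x1 inv_x2 x_index(1) D2_index)
    qed
  qed (use j in \<open>simp add: u_def smult_vec_right_def inv_x1 inv_x2\<close>)
  have v: "v = vec (n - 1) (\<lambda>i. - (conjugate (inverse (\<delta> (q i))) * y $ q i) * inverse (y $ j))"
  proof (rule eq_vecI)
    fix i
    assume "i < dim_vec (vec (n - 1)
      (\<lambda>i. - (conjugate (inverse (\<delta> (q i))) * y $ q i) * inverse (y $ j)))"
    then have i: "i < n - 1" by simp
    show "v $ i =
        vec (n - 1) (\<lambda>i. - (conjugate (inverse (\<delta> (q i))) * y $ q i) * inverse (y $ j)) $ i"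
    proof (cases "i < j")
      case True
      then show ?thesis using i j
        by (simp add: v_def smult_vec_right_def star_y1 star_y2 y_index D1_index q_def)
    next
      case False
      then show ?thesis using i j q2[OF i False] y_index(3)[of "i - j"]
        by (simp add: v_def smult_vec_right_def star_y1 star_y2 y_index(1) D2_index)
    qed
  qed (use j in \<open>simp add: v_def smult_vec_right_def star_y1 star_y2\<close>)
  have "y\<^sub>1 \<star>\<bullet> (mat_inv \<Delta>\<^sub>1 *\<^sub>v x\<^sub>1) = (\<Sum>l<j. conjugate (y $ l) * (inverse (\<delta> l) * x $ l))"
    using y1 by (simp add: star_prod_def scalar_prod_def inv_x1 x_index y_index D1_index
        atLeast0LessThan)
  moreover have "y\<^sub>2 \<star>\<bullet> (mat_inv \<Delta>\<^sub>2 *\<^sub>v x\<^sub>2) = (\<Sum>l<n - j - 1. conjugate (y $ Suc (j + l)) *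
      (inverse (\<delta> (Suc (j + l))) * x $ Suc (j + l)))"
    using y2 by (simp add: star_prod_def scalar_prod_def inv_x2 x_index y_index D2_index
        atLeast0LessThan)
  ultimately have \<alpha>: "\<alpha> = inverse (conjugate (y $ j)) *
      (inverse \<rho> + (\<Sum>l\<in>{..<n} - {j}. conjugate (y $ l) * (inverse (\<delta> l) * x $ l))) *
      inverse (x $ j)"
    by (simp add: \<alpha>_def sum_lessThan_remove[OF j(1)] x_index(1) y_index(1) conjugate_inverse
        add.assoc)
  have car: "D \<in> carrier_mat (n - 1) (n - 1)" "u \<in> carrier_vec (n - 1)" "v \<in> carrier_vec (n - 1)"
    by (simp_all add: D u v)
  have p_j: "tip_perm n j j = n - 1" by (simp add: tip_perm_def)
  have q_p: "q (tip_perm n j k) = k" "tip_perm n j k < n - Suc 0" if "k < n" "k \<noteq> j" for k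
    using that j by (auto simp: q_def tip_perm_def)
  \<comment> \<open>Needed for \<open>D\<close>: its diagonal test compares permuted indices,
    whereas \<open>inverse_singular\<close> compares the original ones.\<close>
  have p_eq: "tip_perm n j k = tip_perm n j l \<longleftrightarrow> k = l" if "k < n" "k \<noteq> j" "l < n" "l \<noteq> j" for k l
    using that q_p by metis
  have "P * arrow_block D u v \<alpha> * transpose_mat P =
      mat n n (\<lambda>(k, l). arrow_block D u v \<alpha> $$ (tip_perm n j k, tip_perm n j l))"
    unfolding P_def using j car by (intro perm_mat_conj arrow_block_carrier tip_perm_less) auto
  also have "\<dots> = mat_inv A"
  proof (rule eq_matI)
    fix k l assume "k < dim_row (mat_inv A)" "l < dim_col (mat_inv A)"
    then have kl: "k < n" "l < n" by (simp_all add: inverse_singular[OF j])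
    then show "mat n n (\<lambda>(k, l). arrow_block D u v \<alpha> $$ (tip_perm n j k, tip_perm n j l)) $$ (k, l) =
        mat_inv A $$ (k, l)"
      using j
      by (cases "k = j"; cases "l = j")
        (simp_all add: arrow_block_index[OF car] tip_perm_less p_j q_p inverse_singular[OF j],
          simp_all add: D u v \<alpha> q_p p_eq conjugate_uminus_times_times)
  qed (simp_all add: inverse_singular[OF j])
  finally show "mat_inv A = P * arrow_block D u v \<alpha> * transpose_mat P" by simp
qed

end

text \<open>The conclusion also asserts that everything inverted is invertible, so the formulas
  never rest on the convention \<open>inverse 0 = 0\<close> or on an arbitrary value of
  \<open>mat_inv\<close>.\<close>

theorem lemma5:
  fixes n :: nat
    and A \<Delta> :: "'a::real_complex_quat mat"
    and x y :: "'a vec"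
    and \<rho> :: 'a
  assumes "\<Delta> \<in> carrier_mat n n" and "diagonal_mat \<Delta>"
    and "x \<in> carrier_vec n" and "y \<in> carrier_vec n"
    and "A = DPR1 \<Delta> x y \<rho>"
    and "invertible_mat A"
  shows
    "((\<forall>j<n. \<Delta> $$ (j, j) \<noteq> 0) \<longrightarrow>
        invertible_mat \<Delta> \<and> 1 + (y \<star>\<bullet> (mat_inv \<Delta> *\<^sub>v x)) * \<rho> \<noteq> 0 \<and>
        (let \<Delta>' = mat_inv \<Delta>;
             x' = mat_inv \<Delta> *\<^sub>v x;
             y' = mat_star (mat_inv \<Delta>) *\<^sub>v y;
             \<rho>' = - \<rho> * inverse (1 + (y \<star>\<bullet> (mat_inv \<Delta> *\<^sub>v x)) * \<rho>)
         in diagonal_mat \<Delta>' \<and> mat_inv A = DPR1 \<Delta>' x' y' \<rho>'))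
     \<and>
     (\<forall>j<n. \<Delta> $$ (j, j) = 0 \<longrightarrow>
        arrowhead_with_tip n j (mat_inv A) \<and>
        (\<forall>\<Delta>\<^sub>1 \<Delta>\<^sub>2 x\<^sub>1 x\<^sub>j x\<^sub>2 y\<^sub>1 y\<^sub>j y\<^sub>2.
           \<Delta>\<^sub>1 \<in> carrier_mat j j \<and> \<Delta>\<^sub>2 \<in> carrier_mat (n - j - 1) (n - j - 1) \<and>
           x\<^sub>1 \<in> carrier_vec j \<and> x\<^sub>2 \<in> carrier_vec (n - j - 1) \<and>
           y\<^sub>1 \<in> carrier_vec j \<and> y\<^sub>2 \<in> carrier_vec (n - j - 1) \<and>
           \<Delta> = diag_block_mat [\<Delta>\<^sub>1, 0\<^sub>m 1 1, \<Delta>\<^sub>2] \<and>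
           x = x\<^sub>1 @\<^sub>v vCons x\<^sub>j x\<^sub>2 \<and>
           y = y\<^sub>1 @\<^sub>v vCons y\<^sub>j y\<^sub>2 \<longrightarrow>
           invertible_mat \<Delta>\<^sub>1 \<and> invertible_mat \<Delta>\<^sub>2 \<and> x\<^sub>j \<noteq> 0 \<and> y\<^sub>j \<noteq> 0 \<and> \<rho> \<noteq> 0 \<and>
           (let P = perm_mat n (tip_perm n j);
                D = diag_block_mat [mat_inv \<Delta>\<^sub>1, mat_inv \<Delta>\<^sub>2];
                u = (- (mat_inv \<Delta>\<^sub>1 *\<^sub>v x\<^sub>1) @\<^sub>v - (mat_inv \<Delta>\<^sub>2 *\<^sub>v x\<^sub>2)) \<cdot>\<^sub>r inverse x\<^sub>j;
                v = (- (mat_star (mat_inv \<Delta>\<^sub>1) *\<^sub>v y\<^sub>1) @\<^sub>v - (mat_star (mat_inv \<Delta>\<^sub>2) *\<^sub>v y\<^sub>2))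
                      \<cdot>\<^sub>r inverse y\<^sub>j;
                \<alpha> = conjugate (inverse y\<^sub>j) *
                      (inverse \<rho> + (y\<^sub>1 \<star>\<bullet> (mat_inv \<Delta>\<^sub>1 *\<^sub>v x\<^sub>1)) + (y\<^sub>2 \<star>\<bullet> (mat_inv \<Delta>\<^sub>2 *\<^sub>v x\<^sub>2))) *
                      inverse x\<^sub>j
            in mat_inv A = P * arrow_block D u v \<alpha> * transpose_mat P)))"
proof -
  interpret dpr1 n \<Delta> x y \<rho>
    using assms by unfold_locales auto
  show ?thesis
    unfolding \<open>A = DPR1 \<Delta> x y \<rho>\<close>
  proof (rule conjI; (intro allI impI)?)
    assume "\<forall>j<n. \<Delta> $$ (j, j) \<noteq> 0"
    then have nz: "\<And>j. j < n \<Longrightarrow> \<Delta> $$ (j, j) \<noteq> 0" by blast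
    note inv = diagonal_mat_inverse[OF \<Delta> nz]
    have diag: "diagonal_mat (mat_inv \<Delta>)" by (simp add: inv(2) diagonal_mat_def)
    show "invertible_mat \<Delta> \<and> 1 + (y \<star>\<bullet> (mat_inv \<Delta> *\<^sub>v x)) * \<rho> \<noteq> 0 \<and>
        (let \<Delta>' = mat_inv \<Delta>;
             x' = mat_inv \<Delta> *\<^sub>v x;
             y' = mat_star (mat_inv \<Delta>) *\<^sub>v y;
             \<rho>' = - \<rho> * inverse (1 + (y \<star>\<bullet> (mat_inv \<Delta> *\<^sub>v x)) * \<rho>)
         in diagonal_mat \<Delta>' \<and> mat_inv (DPR1 \<Delta> x y \<rho>) = DPR1 \<Delta>' x' y' \<rho>')"
      unfolding Let_def by (intro conjI inv(1) inverse_regular[OF nz] diag)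
  next
    fix j assume j: "j < n" "\<Delta> $$ (j, j) = 0"
    show "arrowhead_with_tip n j (mat_inv (DPR1 \<Delta> x y \<rho>)) \<and> (\<forall>\<Delta>\<^sub>1 \<Delta>\<^sub>2 x\<^sub>1 x\<^sub>j x\<^sub>2 y\<^sub>1 y\<^sub>j y\<^sub>2.
           \<Delta>\<^sub>1 \<in> carrier_mat j j \<and> \<Delta>\<^sub>2 \<in> carrier_mat (n - j - 1) (n - j - 1) \<and>
           x\<^sub>1 \<in> carrier_vec j \<and> x\<^sub>2 \<in> carrier_vec (n - j - 1) \<and>
           y\<^sub>1 \<in> carrier_vec j \<and> y\<^sub>2 \<in> carrier_vec (n - j - 1) \<and>
           \<Delta> = diag_block_mat [\<Delta>\<^sub>1, 0\<^sub>m 1 1, \<Delta>\<^sub>2] \<and>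
           x = x\<^sub>1 @\<^sub>v vCons x\<^sub>j x\<^sub>2 \<and>
           y = y\<^sub>1 @\<^sub>v vCons y\<^sub>j y\<^sub>2 \<longrightarrow>
           invertible_mat \<Delta>\<^sub>1 \<and> invertible_mat \<Delta>\<^sub>2 \<and> x\<^sub>j \<noteq> 0 \<and> y\<^sub>j \<noteq> 0 \<and> \<rho> \<noteq> 0 \<and>
           (let P = perm_mat n (tip_perm n j);
                D = diag_block_mat [mat_inv \<Delta>\<^sub>1, mat_inv \<Delta>\<^sub>2];
                u = (- (mat_inv \<Delta>\<^sub>1 *\<^sub>v x\<^sub>1) @\<^sub>v - (mat_inv \<Delta>\<^sub>2 *\<^sub>v x\<^sub>2)) \<cdot>\<^sub>r inverse x\<^sub>j;
                v = (- (mat_star (mat_inv \<Delta>\<^sub>1) *\<^sub>v y\<^sub>1) @\<^sub>v - (mat_star (mat_inv \<Delta>\<^sub>2) *\<^sub>v y\<^sub>2))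
                      \<cdot>\<^sub>r inverse y\<^sub>j;
                \<alpha> = conjugate (inverse y\<^sub>j) *
                      (inverse \<rho> + (y\<^sub>1 \<star>\<bullet> (mat_inv \<Delta>\<^sub>1 *\<^sub>v x\<^sub>1)) + (y\<^sub>2 \<star>\<bullet> (mat_inv \<Delta>\<^sub>2 *\<^sub>v x\<^sub>2))) *
                      inverse x\<^sub>j
            in mat_inv (DPR1 \<Delta> x y \<rho>) = P * arrow_block D u v \<alpha> * transpose_mat P))"
    proof (rule conjI[OF inverse_arrowhead[OF j]], intro allI impI, elim conjE)
      fix \<Delta>\<^sub>1 \<Delta>\<^sub>2 x\<^sub>1 x\<^sub>j x\<^sub>2 y\<^sub>1 y\<^sub>j y\<^sub>2
      assume parts: "\<Delta>\<^sub>1 \<in> carrier_mat j j" "\<Delta>\<^sub>2 \<in> carrier_mat (n - j - 1) (n - j - 1)"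
        "x\<^sub>1 \<in> carrier_vec j" "x\<^sub>2 \<in> carrier_vec (n - j - 1)"
        "y\<^sub>1 \<in> carrier_vec j" "y\<^sub>2 \<in> carrier_vec (n - j - 1)"
        "\<Delta> = diag_block_mat [\<Delta>\<^sub>1, 0\<^sub>m 1 1, \<Delta>\<^sub>2]"
        "x = x\<^sub>1 @\<^sub>v vCons x\<^sub>j x\<^sub>2" "y = y\<^sub>1 @\<^sub>v vCons y\<^sub>j y\<^sub>2"
      show "invertible_mat \<Delta>\<^sub>1 \<and> invertible_mat \<Delta>\<^sub>2 \<and> x\<^sub>j \<noteq> 0 \<and> y\<^sub>j \<noteq> 0 \<and> \<rho> \<noteq> 0 \<and>
           (let P = perm_mat n (tip_perm n j);
                D = diag_block_mat [mat_inv \<Delta>\<^sub>1, mat_inv \<Delta>\<^sub>2];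
                u = (- (mat_inv \<Delta>\<^sub>1 *\<^sub>v x\<^sub>1) @\<^sub>v - (mat_inv \<Delta>\<^sub>2 *\<^sub>v x\<^sub>2)) \<cdot>\<^sub>r inverse x\<^sub>j;
                v = (- (mat_star (mat_inv \<Delta>\<^sub>1) *\<^sub>v y\<^sub>1) @\<^sub>v - (mat_star (mat_inv \<Delta>\<^sub>2) *\<^sub>v y\<^sub>2))
                      \<cdot>\<^sub>r inverse y\<^sub>j;
                \<alpha> = conjugate (inverse y\<^sub>j) *
                      (inverse \<rho> + (y\<^sub>1 \<star>\<bullet> (mat_inv \<Delta>\<^sub>1 *\<^sub>v x\<^sub>1)) + (y\<^sub>2 \<star>\<bullet> (mat_inv \<Delta>\<^sub>2 *\<^sub>v x\<^sub>2))) *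
                      inverse x\<^sub>j
            in mat_inv (DPR1 \<Delta> x y \<rho>) = P * arrow_block D u v \<alpha> * transpose_mat P)"
        unfolding Let_def by (intro conjI inverse_arrow_block[OF j parts])
    qed
  qed
qed

end
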